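(* Let $D$ be a bounded domain in $\mathbb{C}$ with smooth boundary. Then $$\lim_{z\rightarrow \partial D} s_D(z) = 1.$$ In particular, $D$ is a holomorphic homogeneous regular domain.
   Context: $\Delta$ is the open unit disc and $\Delta_r$ the open disc with center $0$ and radius $r$. For a bounded domain $D\subset\mathbb{C}$ and $p\in D$, the squeezing function is $s_D(p)=\sup_f\,\sup\{r:\Delta_r\subset f(D)\}$, where the outer supremum is over all injective holomorphic maps $f:D\to\Delta$ with $f(p)=0$. A holomorphic homogeneous regular domain is a bounded domain whose squeezing function has a positive lower bound. *)

theory Defs
  imports "HOL-Complex_Analysis.Complex_Analysis"
begin

definition bounded_domain :: "complex set \<Rightarrow> bool" where
  "bounded_domain D \<longleftrightarrow> open D \<and> connected D \<and> D \<noteq> {} \<and> bounded D"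

(* Real differentiability: complex is regarded as a real normed vector space of dimension two.
   Meant for open S, where all iterated directional derivatives up to order k exist and those
   of order k are continuous. *)
fun Ck_on :: "nat \<Rightarrow> (complex \<Rightarrow> real) \<Rightarrow> complex set \<Rightarrow> bool" where
  "Ck_on 0 f S \<longleftrightarrow> continuous_on S f"
| "Ck_on (Suc k) f S \<longleftrightarrow>
     (\<forall>x\<in>S. f differentiable (at x)) \<and> (\<forall>v. Ck_on k (\<lambda>x. frechet_derivative f (at x) v) S)"

definition smooth_on :: "(complex \<Rightarrow> real) \<Rightarrow> complex set \<Rightarrow> bool" where
  "smooth_on f S \<longleftrightarrow> (\<forall>k. Ck_on k f S)"

(* Near every boundary point, D is the sublevel set of a smooth local defining function without
   critical points; since the differential does not vanish, frontier D \<inter> U is then exactly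
   the zero set of \<rho> in U, and D lies locally on one side of it. *)
definition smooth_boundary :: "complex set \<Rightarrow> bool" where
  "smooth_boundary D \<longleftrightarrow>
     (\<forall>p\<in>frontier D. \<exists>U \<rho>. open U \<and> p \<in> U \<and> smooth_on \<rho> U \<and>
        (\<forall>z\<in>U. frechet_derivative \<rho> (at z) \<noteq> (\<lambda>v. 0)) \<and>
        D \<inter> U = {z \<in> U. \<rho> z < 0})"

definition disc_embeddings :: "complex set \<Rightarrow> complex \<Rightarrow> (complex \<Rightarrow> complex) set" where
  "disc_embeddings D p =
     {f. f holomorphic_on D \<and> inj_on f D \<and> f ` D \<subseteq> ball 0 1 \<and> f p = 0}"

(* For a bounded domain D and p \<in> D both suprema are over nonempty sets bounded above by 1. *)
definition squeezing :: "complex set \<Rightarrow> complex \<Rightarrow> real" where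
  "squeezing D p = (SUP f\<in>disc_embeddings D p. Sup {r. 0 < r \<and> ball 0 r \<subseteq> f ` D})"

(* The filter of z \<rightarrow> frontier D with z \<in> D: the distance to the frontier tends to 0. *)
definition to_frontier :: "complex set \<Rightarrow> complex filter" where
  "to_frontier D = inf (filtercomap (\<lambda>z. infdist z (frontier D)) (nhds 0)) (principal D)"

definition holomorphic_homogeneous_regular :: "complex set \<Rightarrow> bool" where
  "holomorphic_homogeneous_regular D \<longleftrightarrow>
     bounded_domain D \<and> (\<exists>c>0. \<forall>z\<in>D. c \<le> squeezing D z)"

end

theory Submission
  imports Defs
begin

text \<open>Let p be a boundary point and C the component of the complement of D (on the Riemann sphere)
  that contains p. The boundary being smooth, C is open in the complement and is not a point, so
  the complement of C is a simply connected domain \<Omega> that contains D, and \<Omega> - D is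
  compact. A Riemann map f of \<Omega> onto the disc sends D onto the disc minus a compact set L, and
  the norm of f z tends to 1 as z tends to p. Moving f z to 0 by a disc automorphism pushes L towards
  the unit circle, so the squeezing function tends to 1 at p; compactness of the boundary makes
  this uniform. Away from the boundary, translation and scaling already give a positive lower bound.\<close>

section \<open>Bounds for the squeezing function\<close>

text \<open>The open mapping theorem makes the image of D a neighbourhood of \<open>f p = 0\<close>,
  and a ball inside the unit disc has radius at most 1. Hence the inner \<open>Sup\<close> in
  \<open>squeezing\<close> is a genuine supremum.\<close>

lemma disc_embedding_radii:
  assumes "open D" "p \<in> D" and f: "f \<in> disc_embeddings D p"
  shows "{r. 0 < r \<and> ball 0 r \<subseteq> f ` D} \<noteq> {}" (is "?R \<noteq> {}")
    and "\<And>r. r \<in> {r. 0 < r \<and> ball 0 r \<subseteq> f ` D} \<Longrightarrow> r \<le> 1"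
proof -
  have "open (f ` D)" "0 \<in> f ` D"
    using f assms open_mapping_thm3[of f D] by (auto simp: disc_embeddings_def image_iff)
  then show "?R \<noteq> {}"
    unfolding open_contains_ball by blast
next
  fix r assume "r \<in> ?R"
  then have "0 < r" "ball 0 r \<subseteq> (ball 0 1 :: complex set)"
    using f by (auto simp: disc_embeddings_def)
  then show "r \<le> 1"
    unfolding ball_subset_ball_iff by auto
qed

lemma squeezing_ge:
  assumes "open D" "p \<in> D" and f: "f \<in> disc_embeddings D p" and r: "0 < r" "ball 0 r \<subseteq> f ` D"
  shows "r \<le> squeezing D p"
proof -
  have le1: "Sup {r. 0 < r \<and> ball 0 r \<subseteq> g ` D} \<le> 1" if "g \<in> disc_embeddings D p" for g
    using disc_embedding_radii[OF assms(1,2) that] by (intro cSup_least)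
  have "r \<le> Sup {r. 0 < r \<and> ball 0 r \<subseteq> f ` D}"
    using disc_embedding_radii(2)[OF assms(1-3)] r by (intro cSup_upper bdd_aboveI) auto
  also have "\<dots> \<le> squeezing D p"
    unfolding squeezing_def using le1 f by (intro cSUP_upper bdd_aboveI2[where M = 1])
  finally show ?thesis .
qed

lemma affine_disc_embedding:
  assumes "p \<in> D" "0 < R" "D \<subseteq> ball p R"
  shows "(\<lambda>z. (z - p) / of_real R) \<in> disc_embeddings D p"
proof -
  have "(\<lambda>z. (z - p) / of_real R) holomorphic_on D"
    using assms by (intro holomorphic_intros) auto
  moreover have "inj_on (\<lambda>z. (z - p) / of_real R) D"
    using assms by (auto simp: inj_on_def)
  moreover have "norm ((z - p) / of_real R) < 1" if "z \<in> D" for z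
  proof -
    have "dist p z < R"
      using assms(3) that by auto
    then show ?thesis
      using assms(2) by (simp add: norm_divide dist_norm norm_minus_commute)
  qed
  ultimately show ?thesis
    by (auto simp: disc_embeddings_def)
qed

lemma squeezing_le_1:
  assumes "bounded_domain D" "p \<in> D"
  shows "squeezing D p \<le> 1"
proof -
  have D: "open D" "bounded D"
    using assms by (auto simp: bounded_domain_def)
  obtain R where "0 < R" "D \<subseteq> ball p R"
    using bounded_subset_ballD[OF D(2)] by blast
  \<comment> \<open>The outer supremum must not run over an empty family; boundedness of D supplies
    an affine member.\<close>
  then have "disc_embeddings D p \<noteq> {}"
    using affine_disc_embedding[OF assms(2)] by blast
  moreover have "Sup {r. 0 < r \<and> ball 0 r \<subseteq> g ` D} \<le> 1" if "g \<in> disc_embeddings D p" for g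
    using disc_embedding_radii[OF D(1) assms(2) that] by (intro cSup_least)
  ultimately show ?thesis
    unfolding squeezing_def by (intro cSUP_least)
qed

text \<open>Translation by -p and scaling by 1/R put D into the unit disc and turn
  \<open>ball p d\<close> into \<open>ball 0 (d / R)\<close>. This serves the points at a definite
  distance from the boundary.\<close>

lemma squeezing_ge_affine:
  assumes "open D" "0 < R" "D \<subseteq> ball p R" "0 < d" "ball p d \<subseteq> D"
  shows "d / R \<le> squeezing D p"
proof (rule squeezing_ge[OF \<open>open D\<close>])
  show "p \<in> D"
    using assms(4,5) by auto
  show "(\<lambda>z. (z - p) / of_real R) \<in> disc_embeddings D p"
    using affine_disc_embedding \<open>p \<in> D\<close> assms by blast
  show "0 < d / R"
    using assms by simp
  show "ball 0 (d / R) \<subseteq> (\<lambda>z. (z - p) / of_real R) ` D"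
  proof
    fix w :: complex assume "w \<in> ball 0 (d / R)"
    then have "p + of_real R * w \<in> D"
      using assms by (auto simp: subset_iff dist_norm norm_mult field_simps)
    then show "w \<in> (\<lambda>z. (z - p) / of_real R) ` D"
      using assms by (intro image_eqI[where x = "p + of_real R * w"]) auto
  qed
qed

section \<open>Domains onto which the disc minus a compact set is mapped\<close>

text \<open>With d = |1 - cnj w * z|, the identity d^2 - |z - w|^2 = (1 - |w|^2) (1 - |z|^2)
  controls the quotient, and d is at least 1 - s. So as |w| tends to 1, the automorphism taking w to
  0 pushes the disc of radius s uniformly to the unit circle.\<close>

lemma Moebius_function_norm_ge:
  assumes "norm w < 1" "norm z \<le> s" "s < 1"
  shows "1 - (1 - (norm w)\<^sup>2) / (1 - s)\<^sup>2 \<le> (norm (Moebius_function 0 w z))\<^sup>2"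
proof -
  let ?d = "norm (1 - cnj w * z)"
  have "norm (cnj w * z) \<le> s"
    using mult_mono[of "norm w" 1 "norm z" s] assms by (simp add: norm_mult)
  then have d: "1 - s \<le> ?d"
    using norm_triangle_ineq2[of 1 "cnj w * z"] by simp
  have dpos: "0 < ?d"
    using d assms by linarith
  have "?d\<^sup>2 - (norm (z - w))\<^sup>2 = (1 - (norm w)\<^sup>2) * (1 - (norm z)\<^sup>2)"
    by (simp add: cmod_power2) (simp add: power2_eq_square algebra_simps)
  also have "\<dots> \<le> 1 - (norm w)\<^sup>2"
    using assms by (intro mult_left_le) (auto simp: power_le_one abs_square_le_1)
  finally have "?d\<^sup>2 - (norm (z - w))\<^sup>2 \<le> 1 - (norm w)\<^sup>2" .
  then have "1 - (1 - (norm w)\<^sup>2) / ?d\<^sup>2 \<le> (norm (Moebius_function 0 w z))\<^sup>2"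
    unfolding Moebius_function_simple norm_divide power_divide
    using dpos by (subst diff_le_eq, subst add_divide_distrib[symmetric], subst le_divide_eq) auto
  moreover have "(1 - (norm w)\<^sup>2) / ?d\<^sup>2 \<le> (1 - (norm w)\<^sup>2) / (1 - s)\<^sup>2"
    using assms d dpos by (intro divide_left_mono power_mono mult_pos_pos) (auto simp: power_le_one)
  ultimately show ?thesis
    by linarith
qed

text \<open>Follow F with the automorphism that moves \<open>F z\<close> to 0. The hypothesis on
  \<open>F z\<close> is the preceding estimate solved for the bound r^2: all of L lands at norm at
  least r, which leaves \<open>ball 0 r\<close> free.\<close>

lemma squeezing_ge_disc_minus_compact:
  assumes D: "open D" "z \<in> D"
    and F: "F holomorphic_on D" "inj_on F D" "F ` D = ball 0 1 - L"
    and L: "L \<subseteq> cball 0 s" "s < 1"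
    and r: "0 < r" "r < 1"
    and Fz: "1 - (1 - r\<^sup>2) * (1 - s)\<^sup>2 \<le> (norm (F z))\<^sup>2"
  shows "r \<le> squeezing D z"
proof (rule squeezing_ge[OF D])
  let ?w = "F z" and ?\<phi> = "Moebius_function 0 (F z)"
  have w: "norm ?w < 1"
    using F(3) D by auto
  have left_inv: "Moebius_function 0 (- ?w) (?\<phi> u) = u" if "norm u < 1" for u
    using Moebius_function_compose[of "- ?w" ?w u] w that by simp
  have right_inv: "?\<phi> (Moebius_function 0 (- ?w) v) = v" if "norm v < 1" for v
    using Moebius_function_compose[of ?w "- ?w" v] w that by simp
  have FD: "F ` D \<subseteq> ball 0 1"
    using F(3) by blast
  have "inj_on ?\<phi> (F ` D)"
    using FD left_inv by (intro inj_on_inverseI[where g = "Moebius_function 0 (- ?w)"]) auto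
  then have "inj_on (?\<phi> \<circ> F) D"
    using F(2) by (rule comp_inj_on[rotated])
  moreover have "(?\<phi> \<circ> F) holomorphic_on D"
    using holomorphic_on_compose_gen[OF F(1) Moebius_function_holomorphic[OF w] FD] .
  ultimately show "?\<phi> \<circ> F \<in> disc_embeddings D z"
    using FD Moebius_function_norm_lt_1[OF w]
    by (auto simp: disc_embeddings_def Moebius_function_eq_zero)
  show "ball 0 r \<subseteq> (?\<phi> \<circ> F) ` D"
  proof
    fix v :: complex assume v: "v \<in> ball 0 r"
    \<comment> \<open>The automorphism sends \<open>?u\<close> to v, so v is attained once
      \<open>?u\<close> is known to avoid L.\<close>
    let ?u = "Moebius_function 0 (- ?w) v"
    have v1: "norm v < 1"
      using v r by simp
    have u: "?u \<in> ball 0 1"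
      using Moebius_function_norm_lt_1[of "- ?w" v] w v1 by simp
    have "?u \<notin> L"
    proof
      assume "?u \<in> L"
      then have "norm ?u \<le> s"
        using L by auto
      then have "1 - (1 - (norm ?w)\<^sup>2) / (1 - s)\<^sup>2 \<le> (norm v)\<^sup>2"
        using Moebius_function_norm_ge[OF w _ L(2), of ?u] right_inv[OF v1] by simp
      moreover have "(1 - (norm ?w)\<^sup>2) / (1 - s)\<^sup>2 \<le> 1 - r\<^sup>2"
        using Fz L(2) by (simp add: field_simps)
      moreover have "(norm v)\<^sup>2 < r\<^sup>2"
        using v r by (intro power_strict_mono) auto
      ultimately show False
        by linarith
    qed
    then have "?u \<in> F ` D"
      using u F(3) by blast
    then obtain x where "x \<in> D" "F x = ?u"
      by auto
    then show "v \<in> (?\<phi> \<circ> F) ` D"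
      using right_inv[OF v1] by (intro image_eqI[where x = x]) auto
  qed
qed (rule r)

text \<open>Here \<open>\<iota>\<close> will be the identity or an inversion, and
  \<open>\<Omega>\<close> the image of D with all holes but one filled. For z near p,
  \<open>\<iota> z\<close> is near a point outside \<open>\<Omega>\<close>, so it escapes any given
  compact subset of \<open>\<Omega>\<close>, and a Riemann map sends it close to the unit
  circle.\<close>

lemma squeezing_near_1:
  assumes D: "open D" "D \<noteq> {}"
    and \<iota>: "\<iota> holomorphic_on D" "inj_on \<iota> D" "\<iota> ` D \<subseteq> \<Omega>" "continuous (at p) \<iota>" "\<iota> p \<notin> \<Omega>"
    and \<Omega>: "open \<Omega>" "simply_connected \<Omega>" "compact (\<Omega> - \<iota> ` D)"
    and r: "0 < r" "r < 1"
  shows "\<exists>\<delta>>0. \<forall>z\<in>D. dist z p < \<delta> \<longrightarrow> r \<le> squeezing D z"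
proof -
  obtain f g where f: "f holomorphic_on \<Omega>" and g: "g holomorphic_on ball 0 1"
    and gf: "\<And>z. z \<in> \<Omega> \<Longrightarrow> f z \<in> ball 0 1 \<and> g (f z) = z"
    and fg: "\<And>w. w \<in> ball 0 1 \<Longrightarrow> g w \<in> \<Omega> \<and> f (g w) = w"
  proof -
    have "\<Omega> \<noteq> {}" "\<Omega> \<noteq> UNIV"
      using D(2) \<iota>(3,5) by auto
    then show thesis
      using Riemann_mapping_theorem[of \<Omega>] \<Omega>(1,2) that by metis
  qed
  \<comment> \<open>The part of the disc that D does not cover. Its compactness yields s < 1: the
    largest norm on L, or 0 when L is empty.\<close>
  define L where "L = f ` (\<Omega> - \<iota> ` D)"
  have "compact L"
    unfolding L_def using \<Omega>(3) f
    by (meson Diff_subset compact_continuous_image continuous_on_subset holomorphic_on_imp_continuous_on)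
  moreover have "L \<subseteq> ball 0 1"
    using gf unfolding L_def by auto
  ultimately obtain s where s: "0 \<le> s" "s < 1" "L \<subseteq> cball 0 s"
  proof (cases "L = {}")
    case False
    then obtain x where x: "x \<in> L" "\<And>y. y \<in> L \<Longrightarrow> norm y \<le> norm x"
      using continuous_attains_sup[of L norm] \<open>compact L\<close> by (auto intro: continuous_intros)
    show ?thesis
      using x \<open>L \<subseteq> ball 0 1\<close> by (intro that[of "norm x"]) auto
  qed (auto intro: that[of 0])
  define F where "F = f \<circ> \<iota>"
  have "inj_on f (\<iota> ` D)"
    using gf \<iota>(3) by (intro inj_on_inverseI[where g = g]) auto
  then have F: "F holomorphic_on D" "inj_on F D"
    unfolding F_def using holomorphic_on_compose_gen[OF \<iota>(1) f \<iota>(3)] comp_inj_on[OF \<iota>(2)] by auto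
  have FD: "F ` D = ball 0 1 - L"
  proof (intro equalityI subsetI)
    fix w assume "w \<in> F ` D"
    then obtain x where x: "x \<in> D" "w = f (\<iota> x)"
      by (auto simp: F_def)
    have "w \<notin> L"
      using x gf \<iota>(3) unfolding L_def by (smt (verit) Diff_iff imageE image_subset_iff image_eqI)
    then show "w \<in> ball 0 1 - L"
      using x gf \<iota>(3) by blast
  next
    fix w assume w: "w \<in> ball 0 1 - L"
    then have "g w \<in> \<iota> ` D"
      using fg[of w] unfolding L_def by (metis DiffD1 DiffD2 DiffI image_eqI)
    then show "w \<in> F ` D"
      using fg[of w] w unfolding F_def by (metis DiffD1 comp_apply imageE image_eqI)
  qed
  \<comment> \<open>Chosen so that t^2 is the threshold that
    \<open>squeezing_ge_disc_minus_compact\<close> puts on |F z|^2; it remains to force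
    \<open>F z\<close> out of \<open>cball 0 t\<close>.\<close>
  define a where "a = (1 - r\<^sup>2) * (1 - s)\<^sup>2"
  define t where "t = sqrt (1 - a)"
  have a: "0 < a" "a \<le> 1"
    unfolding a_def using r s
    by (auto intro!: mult_pos_pos mult_le_one simp: power_le_one power_less_one_iff abs_square_less_1)
  then have t: "0 \<le> t" "t < 1" "t\<^sup>2 = 1 - a"
    by (auto simp: t_def)
  have cb: "cball 0 t \<subseteq> (ball 0 1 :: complex set)"
    using t by auto
  \<comment> \<open>Since g inverts f, this set consists of the points of \<open>\<Omega>\<close>
    that f sends into \<open>cball 0 t\<close>. It is closed and misses \<open>\<iota> p\<close>,
    hence misses a ball around it.\<close>
  have "compact (g ` cball 0 t)"
    using g cb by (meson compact_cball compact_continuous_image continuous_on_subset holomorphic_on_imp_continuous_on)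
  moreover have "\<iota> p \<notin> g ` cball 0 t"
    using \<iota>(5) fg cb by (metis imageE subsetD)
  ultimately have "open (- (g ` cball 0 t))" "\<iota> p \<in> - (g ` cball 0 t)"
    by (auto simp: compact_imp_closed)
  then obtain \<eta> where \<eta>: "\<eta> > 0" "ball (\<iota> p) \<eta> \<subseteq> - (g ` cball 0 t)"
    by (meson openE)
  obtain \<delta> where \<delta>: "\<delta> > 0" "\<And>z. dist z p < \<delta> \<Longrightarrow> dist (\<iota> z) (\<iota> p) < \<eta>"
    using \<iota>(4) \<eta>(1) unfolding continuous_at_eps_delta by metis
  have "r \<le> squeezing D z" if z: "z \<in> D" "dist z p < \<delta>" for z
  proof (rule squeezing_ge_disc_minus_compact[OF D(1) z(1) F FD s(3,2) r])
    have "\<iota> z \<notin> g ` cball 0 t"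
      using \<delta>(2)[OF z(2)] \<eta>(2) by (auto simp: dist_commute)
    then have "F z \<notin> cball 0 t"
      using gf[of "\<iota> z"] \<iota>(3) z(1) unfolding F_def by (metis comp_apply image_eqI image_subset_iff)
    then have "t\<^sup>2 \<le> (norm (F z))\<^sup>2"
      using t by (intro power_mono) auto
    then show "1 - (1 - r\<^sup>2) * (1 - s)\<^sup>2 \<le> (norm (F z))\<^sup>2"
      using t by (simp add: a_def)
  qed
  then show ?thesis
    using \<delta>(1) by blast
qed

section \<open>The complement of a smoothly bounded domain\<close>

text \<open>Near a boundary point the derivative of the defining function in some direction v is
  positive, so moving along v does not leave the complement and leads into a ball inside it.\<close>

lemma smooth_boundary_complement:
  assumes D: "open D" "smooth_boundary D" and p: "p \<in> frontier D"
  obtains T a \<delta> where "connected T" "T \<subseteq> - D" "0 < \<delta>" "ball p \<delta> - D \<subseteq> T" "ball a \<delta> \<subseteq> T"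
proof -
  obtain U \<rho> where U: "open U" "p \<in> U" and sm: "smooth_on \<rho> U"
    and nz: "frechet_derivative \<rho> (at p) \<noteq> (\<lambda>v. 0)" and DU: "D \<inter> U = {z \<in> U. \<rho> z < 0}"
    using D p unfolding smooth_boundary_def by metis
  have C1: "Ck_on (Suc 0) \<rho> U"
    using sm by (auto simp: smooth_on_def)
  then have diff: "\<And>x. x \<in> U \<Longrightarrow> (\<rho> has_derivative frechet_derivative \<rho> (at x)) (at x)"
    and cont: "\<And>v. continuous_on U (\<lambda>x. frechet_derivative \<rho> (at x) v)"
    by (auto simp: frechet_derivative_works)
  have lin: "\<And>x. x \<in> U \<Longrightarrow> linear (frechet_derivative \<rho> (at x))"
    using diff has_derivative_linear by blast
  obtain v where v: "frechet_derivative \<rho> (at p) v > 0"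
  proof -
    obtain v where "frechet_derivative \<rho> (at p) v \<noteq> 0"
      using nz by auto
    moreover have "frechet_derivative \<rho> (at p) (- v) = - frechet_derivative \<rho> (at p) v"
      using lin[OF U(2)] by (rule linear_neg)
    ultimately show ?thesis
      using that[of v] that[of "- v"] by linarith
  qed
  then have "v \<noteq> 0"
    using linear_0[OF lin[OF U(2)]] by auto
  have "open {x \<in> U. frechet_derivative \<rho> (at x) v > 0}"
    using continuous_open_preimage[OF cont[of v] U(1), of "{0<..}"]
    by (simp add: vimage_def Int_def)
  then obtain R where R: "R > 0" and "ball p R \<subseteq> {x \<in> U. frechet_derivative \<rho> (at x) v > 0}"
    using U v by (metis (mono_tags, lifting) mem_Collect_eq openE)
  then have RU: "ball p R \<subseteq> U" and pos: "\<And>x. x \<in> ball p R \<Longrightarrow> frechet_derivative \<rho> (at x) v > 0"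
    by auto
  have incr: "\<rho> q < \<rho> (q + t *\<^sub>R v)"
    if "0 < t" and seg: "\<And>x. 0 \<le> x \<Longrightarrow> x \<le> t \<Longrightarrow> q + x *\<^sub>R v \<in> ball p R" for q t
  proof -
    have "((\<lambda>x. \<rho> (q + x *\<^sub>R v)) has_real_derivative frechet_derivative \<rho> (at (q + x *\<^sub>R v)) v) (at x)"
      if "0 \<le> x" "x \<le> t" for x
    proof -
      have *: "q + x *\<^sub>R v \<in> U"
        using seg that RU by blast
      have "((\<lambda>x. \<rho> (q + x *\<^sub>R v)) has_derivative (\<lambda>h. frechet_derivative \<rho> (at (q + x *\<^sub>R v)) (h *\<^sub>R v))) (at x)"
        by (rule has_derivative_compose[where g = \<rho>]) (auto intro!: derivative_eq_intros diff[OF *])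
      moreover have "frechet_derivative \<rho> (at (q + x *\<^sub>R v)) (h *\<^sub>R v)
          = frechet_derivative \<rho> (at (q + x *\<^sub>R v)) v * h" for h
        using linear_scale[OF lin[OF *], of h v] by simp
      ultimately show ?thesis
        by (simp add: has_field_derivative_def)
    qed
    then have "\<rho> (q + 0 *\<^sub>R v) < \<rho> (q + t *\<^sub>R v)"
      using pos seg \<open>0 < t\<close> by (intro DERIV_pos_imp_increasing[where f = "\<lambda>x. \<rho> (q + x *\<^sub>R v)"]) blast+
    then show ?thesis
      by simp
  qed
  \<comment> \<open>A displacement of length R/2: a motion along v that starts within R/2 of p stays
    in \<open>ball p R\<close>, where the derivative along v is positive.\<close>
  define \<tau> where "\<tau> = R / (2 * norm v)"
  have \<tau>: "0 < \<tau>" "\<tau> * norm v = R / 2"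
    using R \<open>v \<noteq> 0\<close> by (auto simp: \<tau>_def)
  define a where "a = p + \<tau> *\<^sub>R v"
  have segR: "q + x *\<^sub>R v \<in> ball p R" if "q \<in> ball p (R / 2)" "0 \<le> x" "x \<le> \<tau>" for q x
  proof -
    have "norm (x *\<^sub>R v) \<le> R / 2"
      using mult_right_mono[of x \<tau> "norm v"] that \<tau> by simp
    then have "dist p (q + x *\<^sub>R v) < R"
      using that(1) norm_triangle_ineq4[of "p - q" "x *\<^sub>R v"] by (simp add: dist_norm algebra_simps)
    then show ?thesis
      by simp
  qed
  have "p \<notin> D"
    using p D(1) by (simp add: frontier_def interior_open)
  then have "0 \<le> \<rho> p"
    using DU U by force
  then have "0 < \<rho> a"
    using incr[OF \<tau>(1), of p] segR[of p] R unfolding a_def by force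
  have contU: "continuous_on (ball p R) \<rho>"
    using diff RU by (meson continuous_at_imp_continuous_on has_derivative_continuous subsetD)
  have "open {x \<in> ball p R. \<rho> x > 0}"
    using continuous_open_preimage[OF contU open_ball, of "{0<..}"]
    by (simp add: vimage_def Int_def)
  moreover have "a \<in> {x \<in> ball p R. \<rho> x > 0}"
    using \<open>0 < \<rho> a\<close> segR[of p \<tau>] \<tau> R by (simp add: a_def)
  ultimately obtain \<epsilon> where \<epsilon>: "\<epsilon> > 0" "ball a \<epsilon> \<subseteq> {x \<in> ball p R. \<rho> x > 0}"
    by (meson openE)
  \<comment> \<open>One radius for both balls, so that translation by
    \<open>\<tau> *\<^sub>R v\<close> carries \<open>ball p \<delta>\<close> onto
    \<open>ball a \<delta>\<close>.\<close>
  define \<delta> where "\<delta> = min \<epsilon> (R / 2)"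
  have \<delta>: "0 < \<delta>" "ball a \<delta> \<subseteq> {x \<in> ball p R. \<rho> x > 0}" "ball p \<delta> \<subseteq> ball p (R / 2)"
    using \<epsilon> R unfolding \<delta>_def by auto
  have notD: "x \<notin> D" if "x \<in> ball p R" "0 \<le> \<rho> x" for x
    using that RU DU by force
  \<comment> \<open>The segments along v from complement points near p. Each ends in
    \<open>ball a \<delta>\<close>, so together with that ball they form a connected set.\<close>
  define S where "S = (\<lambda>q. (\<lambda>x. q + x *\<^sub>R v) ` {0..\<tau>}) ` (ball p \<delta> - D)"
  show ?thesis
  proof (rule that[of "ball a \<delta> \<union> \<Union>S"])
    show "connected (ball a \<delta> \<union> \<Union>S)"
    proof (rule connected_Un_UN)
      fix X assume "X \<in> S"
      then obtain q where q: "q \<in> ball p \<delta>" "X = (\<lambda>x. q + x *\<^sub>R v) ` {0..\<tau>}"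
        by (auto simp: S_def)
      then show "connected X"
        by (auto intro!: connected_continuous_image continuous_intros)
      have "q + \<tau> *\<^sub>R v \<in> ball a \<delta> \<inter> X"
        using q \<tau> by (auto simp: a_def)
      then show "ball a \<delta> \<inter> X \<noteq> {}"
        by blast
    qed auto
    show "ball a \<delta> \<union> \<Union>S \<subseteq> - D"
    proof -
      have "q + x *\<^sub>R v \<notin> D" if q: "q \<in> ball p \<delta>" "q \<notin> D" and x: "0 \<le> x" "x \<le> \<tau>" for q x
      proof (cases "x = 0")
        case False
        have q2: "q \<in> ball p (R / 2)"
          using q \<delta> by blast
        then have "q \<in> U"
          using RU R by auto
        then have "0 \<le> \<rho> q"
          using q DU by force
        moreover have "\<rho> q < \<rho> (q + x *\<^sub>R v)"
          using False x segR[OF q2] by (intro incr) auto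
        ultimately show ?thesis
          using segR[OF q2 x] notD by force
      qed (use q in auto)
      moreover have "ball a \<delta> \<inter> D = {}"
        using \<delta>(2) notD by force
      ultimately show ?thesis
        by (auto simp: S_def)
    qed
    show "ball p \<delta> - D \<subseteq> ball a \<delta> \<union> \<Union>S"
    proof
      fix q assume "q \<in> ball p \<delta> - D"
      moreover have "q \<in> (\<lambda>x. q + x *\<^sub>R v) ` {0..\<tau>}"
        using \<tau> by (intro image_eqI[where x = 0]) auto
      ultimately show "q \<in> ball a \<delta> \<union> \<Union>S"
        unfolding S_def by blast
    qed
  qed (use \<delta> in auto)
qed

text \<open>Near a frontier point of C, all complement points lie in one connected subset of the
  complement, hence in C; around any other point of C a whole ball avoids D and falls into C.
  Openness of \<open>D \<union> C\<close> will make the filled holes closed, and the ball inside C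
  supplies a centre of inversion.\<close>

lemma smooth_boundary_component:
  assumes D: "open D" "smooth_boundary D" and C: "C \<in> components (- D)"
  shows "open (D \<union> C)"
    and "p \<in> C \<Longrightarrow> p \<in> frontier D \<Longrightarrow> \<exists>a \<delta>. 0 < \<delta> \<and> ball a \<delta> \<subseteq> C"
proof -
  have *: "\<exists>a \<delta>. 0 < \<delta> \<and> ball q \<delta> - D \<subseteq> C \<and> ball a \<delta> \<subseteq> C" if q: "q \<in> C" "q \<in> frontier D" for q
  proof -
    obtain T a \<delta> where T: "connected T" "T \<subseteq> - D" "0 < \<delta>" "ball q \<delta> - D \<subseteq> T" "ball a \<delta> \<subseteq> T"
      using smooth_boundary_complement[OF D q(2)] by metis
    have "q \<notin> D"
      using q C in_components_subset by blast
    then have "q \<in> T"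
      using T by auto
    then have "T \<subseteq> C"
      using components_maximal[OF C T(1,2)] q(1) by blast
    then show ?thesis
      using T by blast
  qed
  then show "p \<in> C \<Longrightarrow> p \<in> frontier D \<Longrightarrow> \<exists>a \<delta>. 0 < \<delta> \<and> ball a \<delta> \<subseteq> C"
    by blast
  have "\<exists>e>0. ball q e \<subseteq> D \<union> C" if "q \<in> C" for q
  proof (cases "q \<in> frontier D")
    case True
    then show ?thesis
      using *[OF that] by blast
  next
    case False
    moreover have "q \<notin> D"
      using that C in_components_subset by blast
    ultimately have "q \<in> - closure D"
      using D(1) by (simp add: frontier_def interior_open)
    then obtain e where e: "e > 0" "ball q e \<subseteq> - closure D"
      by (meson openE open_Compl closed_closure)
    then have "ball q e \<subseteq> - D"
      using closure_subset by blast
    then have "ball q e \<subseteq> C"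
      using components_maximal[OF C connected_ball] e(1) that by (metis centre_in_ball disjoint_iff)
    then show ?thesis
      using e(1) by blast
  qed
  moreover have "\<exists>e>0. ball q e \<subseteq> D \<union> C" if "q \<in> D" for q
    using D(1) that by (meson openE le_supI1)
  ultimately show "open (D \<union> C)"
    unfolding open_contains_ball by blast
qed

text \<open>C without a smaller ball and the punctured larger ball are both connected and share an
  annulus. This is used for the inversion, which sends the deleted point to infinity.\<close>

lemma connected_delete_interior_point:
  fixes C :: "'a::euclidean_space set"
  assumes C: "connected C" and a: "0 < d" "ball a d \<subseteq> C" and dim: "2 \<le> DIM('a)"
  shows "connected (C - {a})"
proof -
  have "cball a (d / 2) \<subseteq> C"
    using a by force
  then have "connected (C - ball a (d / 2))"
    using connected_diff_ball[OF C _ dim] by blast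
  moreover have "connected (ball a d - {a})"
    using dim by (rule connected_punctured_ball)
  moreover have "(C - ball a (d / 2)) \<inter> (ball a d - {a}) \<noteq> {}"
  proof -
    obtain i :: 'a where "i \<in> Basis"
      using nonempty_Basis by blast
    then have "a + (d / 2) *\<^sub>R i \<in> (C - ball a (d / 2)) \<inter> (ball a d - {a})"
      using a by (auto simp: dist_norm nonzero_Basis subset_iff)
    then show ?thesis
      by blast
  qed
  ultimately have "connected ((C - ball a (d / 2)) \<union> (ball a d - {a}))"
    by (rule connected_Un)
  moreover have "(C - ball a (d / 2)) \<union> (ball a d - {a}) = C - {a}"
    using a by auto
  ultimately show ?thesis
    by simp
qed

section \<open>Boundary behaviour of the squeezing function\<close>

text \<open>If the component C of the complement through p is bounded, inversion in an interior point
  a of C makes it unbounded.  As inverse 0 = 0 in HOL, the map w \<mapsto> inverse (w - a) is a bijection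
  of the plane; the added point 0 of \<Omega> stands for the point at infinity.\<close>

lemma squeezing_near_1_frontier:
  assumes D: "bounded_domain D" "smooth_boundary D" and p: "p \<in> frontier D" and r: "0 < r" "r < 1"
  shows "\<exists>\<delta>>0. \<forall>z\<in>D. dist z p < \<delta> \<longrightarrow> r \<le> squeezing D z"
proof -
  have dom: "open D" "connected D" "D \<noteq> {}" "bounded D"
    using D(1) by (auto simp: bounded_domain_def)
  have "p \<notin> D"
    using p dom(1) by (simp add: frontier_def interior_open)
  then obtain C where C: "C \<in> components (- D)" and "p \<in> C"
    by (metis ComplI UnionE Union_components)
  have CD: "C \<subseteq> - D" and conC: "connected C"
    using C in_components_subset in_components_connected by blast+
  have clC: "closed C"
    using closed_components[OF _ C] dom(1) by blast
  have opDC: "open (D \<union> C)"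
    using smooth_boundary_component(1)[OF dom(1) D(2) C] .
  have conC': "connected (- C)"
    using component_complement_connected[OF dom(2) C] .
  obtain R where R: "0 < R" "D \<subseteq> ball 0 R"
    using bounded_subset_ballD[OF dom(4)] by blast
  show ?thesis
  proof (cases "bounded C")
    case False
    \<comment> \<open>The exterior of the ball is connected and avoids D, so it lies in a single
      component, which is the unbounded C. The remaining holes are therefore bounded.\<close>
    have "- ball 0 R \<subseteq> C"
    proof (rule components_maximal[OF C])
      show "connected (- ball 0 R :: complex set)"
        by (intro connected_complement_bounded_convex) auto
      show "C \<inter> - ball 0 R \<noteq> {}"
        using False bounded_subset[OF bounded_ball] by blast
    qed (use R in auto)
    then have "bounded (- C - D)"
      by (intro bounded_subset[OF bounded_ball[of 0 R]]) auto
    moreover have "closed (- C - D)"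
      using opDC by (simp add: closed_def Un_commute Diff_eq Compl_Int)
    ultimately have "compact (- C - id ` D)"
      by (simp add: compact_eq_bounded_closed)
    \<comment> \<open>The complement of \<open>- C\<close> has the single component C, and C is
      unbounded.\<close>
    moreover have "simply_connected (- C)"
      using clC conC conC' False
      by (metis components_eq_sing_iff bounded_empty double_complement open_Compl singletonD
          simply_connected_eq_unbounded_complement_components)
    ultimately show ?thesis
      using CD clC \<open>p \<in> C\<close> dom
      by (intro squeezing_near_1[where \<iota> = id and \<Omega> = "- C"]) (auto intro: r)
  next
    case True
    obtain a d where d: "0 < d" and ad: "ball a d \<subseteq> C"
      using smooth_boundary_component(2)[OF dom(1) D(2) C \<open>p \<in> C\<close> p] by blast
    define \<iota> where "\<iota> = (\<lambda>w. inverse (w - a))"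
    have \<iota>_eq: "\<iota> ` X = {w. a + inverse w \<in> X}" for X
      by (auto simp: \<iota>_def image_iff intro!: bexI[of _ "a + inverse _"])
    have injI: "inj_on \<iota> X" for X
      by (auto simp: \<iota>_def inj_on_def)
    have "a \<in> C"
      using d ad by auto
    then have "a \<notin> D"
      using CD by blast
    have pa: "p \<noteq> a"
    proof
      assume "p = a"
      then have "p \<in> interior (- D)"
        using d ad CD by (metis centre_in_ball interior_maximal open_ball order_trans subsetD)
      then show False
        using p by (auto simp: frontier_def interior_closure)
    qed
    have hol: "\<iota> holomorphic_on X" if "a \<notin> X" for X
      unfolding \<iota>_def using that by (intro holomorphic_intros) auto
    have opI: "open (\<iota> ` (X - {a}))" if "open X" for X
      using hol injI that by (intro open_mapping_thm3) auto
    \<comment> \<open>Leaving out a is what puts \<open>\<iota> a = 0\<close> into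
      \<open>\<Omega>\<close>.\<close>
    define \<Omega> where "\<Omega> = - \<iota> ` (C - {a})"
    obtain R' where R': "0 < R'" "C \<subseteq> ball a R'"
      using bounded_subset_ballD[OF True] by blast
    \<comment> \<open>Nonzero points near 0 come from points far from a, beyond the bounded set C.
      This makes \<open>\<Omega>\<close> open at 0.\<close>
    have near0: "ball 0 (1 / R') \<subseteq> \<Omega>"
    proof
      fix w :: complex assume "w \<in> ball 0 (1 / R')"
      then have "w = 0 \<or> R' \<le> norm (inverse w)"
        using R' by (simp add: norm_divide inverse_eq_divide le_divide_eq less_divide_eq mult.commute)
      moreover have "norm (inverse w) < R'" if "a + inverse w \<in> C"
        using R'(2) that by (auto simp: subset_iff dist_norm)
      ultimately show "w \<in> \<Omega>"
        by (auto simp: \<Omega>_def \<iota>_eq)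
    qed
    have \<Omega>_eq: "\<Omega> = \<iota> ` (- C - {a}) \<union> ball 0 (1 / R')"
      using near0 \<open>a \<in> C\<close> unfolding \<Omega>_def \<iota>_eq by (auto simp: R')
    have op\<Omega>: "open \<Omega>"
      unfolding \<Omega>_eq using clC by (intro open_Un opI open_ball) auto
    \<comment> \<open>The inversion throws the punctured \<open>ball a d\<close>, a part of C, onto
      the exterior of this disc.\<close>
    have bd: "\<Omega> \<subseteq> cball 0 (1 / d)"
    proof
      fix w assume w: "w \<in> \<Omega>"
      show "w \<in> cball 0 (1 / d)"
      proof (rule ccontr)
        assume "w \<notin> cball 0 (1 / d)"
        then have "1 / d < norm w"
          by auto
        moreover from this have "w \<noteq> 0"
          using d by auto
        ultimately have "norm (inverse w) < d"
          using d by (simp add: norm_divide inverse_eq_divide divide_less_eq mult.commute)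
        then have "a + inverse w \<in> C"
          using ad by (auto simp: dist_norm)
        then show False
          using w \<open>w \<noteq> 0\<close> by (auto simp: \<Omega>_def \<iota>_eq)
      qed
    qed
    have bd\<Omega>: "bounded \<Omega>"
      using bd bounded_cball bounded_subset by blast
    have cont: "continuous_on X \<iota>" if "a \<notin> X" for X
      using hol[OF that] by (rule holomorphic_on_imp_continuous_on)
    have "connected \<Omega>"
      unfolding \<Omega>_eq
    proof (rule connected_Un)
      show "connected (\<iota> ` (- C - {a}))"
        using conC' \<open>a \<in> C\<close> cont[of "- C"] by (simp add: connected_continuous_image)
      obtain w :: complex where w: "w \<in> ball 0 (1 / R')" "w \<noteq> 0"
        using R'(1) by (intro that[of "of_real (1 / (2 * R'))"]) (auto simp: norm_divide field_simps)
      then have "w \<in> \<iota> ` (- C - {a})"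
        using near0 by (auto simp: \<Omega>_def \<iota>_eq)
      then show "\<iota> ` (- C - {a}) \<inter> ball 0 (1 / R') \<noteq> {}"
        using w by blast
    qed auto
    \<comment> \<open>For a bounded open plane set, simple connectedness amounts to connectedness of
      the set and of its complement.\<close>
    moreover have "connected (- \<Omega>)"
      unfolding \<Omega>_def using connected_delete_interior_point[OF conC d ad] cont[of "C - {a}"]
      by (simp add: connected_continuous_image)
    ultimately have sc: "simply_connected \<Omega>"
      using simply_connected_iff_simple[OF op\<Omega> bd\<Omega>] by blast
    have "closed (\<Omega> - \<iota> ` D)"
    proof -
      \<comment> \<open>This exhibits the filled holes as the complement of the image of an open set
        under an injective holomorphic map.\<close>
      have "\<Omega> - \<iota> ` D = - \<iota> ` ((D \<union> C) - {a})"
        using \<open>a \<notin> D\<close> by (auto simp: \<Omega>_def \<iota>_eq)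
      then show ?thesis
        using opI[OF opDC] by auto
    qed
    then have cpt: "compact (\<Omega> - \<iota> ` D)"
      using bd\<Omega> bounded_diff compact_eq_bounded_closed by blast
    show ?thesis
    proof (rule squeezing_near_1[OF dom(1,3) hol[OF \<open>a \<notin> D\<close>] injI _ _ _ op\<Omega> sc cpt r])
      show "\<iota> ` D \<subseteq> \<Omega>"
        using CD by (auto simp: \<Omega>_def \<iota>_eq)
      show "continuous (at p) \<iota>"
        unfolding \<iota>_def using pa by (intro continuous_intros) auto
      show "\<iota> p \<notin> \<Omega>"
        using \<open>p \<in> C\<close> pa by (auto simp: \<Omega>_def)
    qed
  qed
qed

section \<open>Uniformity along the boundary and the global lower bound\<close>

lemma squeezing_near_1_uniform:
  assumes D: "bounded_domain D" "smooth_boundary D" and r: "0 < r" "r < 1"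
  shows "\<exists>\<delta>>0. \<forall>z\<in>D. infdist z (frontier D) < \<delta> \<longrightarrow> r \<le> squeezing D z"
proof -
  have dom: "open D" "D \<noteq> {}" "bounded D"
    using D(1) by (auto simp: bounded_domain_def)
  have ne: "frontier D \<noteq> {}"
    using dom by (metis frontier_not_empty not_bounded_UNIV)
  have cpt: "compact (frontier D)"
    using dom(3) by (rule compact_frontier_bounded)
  obtain \<delta> where \<delta>: "\<And>p. p \<in> frontier D \<Longrightarrow> 0 < \<delta> p"
    "\<And>p z. p \<in> frontier D \<Longrightarrow> z \<in> D \<Longrightarrow> dist z p < \<delta> p \<Longrightarrow> r \<le> squeezing D z"
    using squeezing_near_1_frontier[OF D _ r] by metis
  have sub: "frontier D \<subseteq> (\<Union>p\<in>frontier D. ball p (\<delta> p))"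
    using \<delta>(1) by force
  \<comment> \<open>By compactness the pointwise neighbourhoods contain a neighbourhood of the
    frontier of uniform width.\<close>
  obtain \<epsilon> where \<epsilon>: "\<epsilon> > 0" "(\<Union>x\<in>frontier D. ball x \<epsilon>) \<subseteq> (\<Union>p\<in>frontier D. ball p (\<delta> p))"
    by (rule compact_subset_open_imp_ball_epsilon_subset[OF cpt _ sub]) auto
  have "r \<le> squeezing D z" if z: "z \<in> D" "infdist z (frontier D) < \<epsilon>" for z
  proof -
    obtain x where "x \<in> frontier D" "infdist z (frontier D) = dist z x"
      using infdist_attains_inf[OF compact_imp_closed[OF cpt] ne] by metis
    then have "z \<in> (\<Union>x\<in>frontier D. ball x \<epsilon>)"
      using z by (auto simp: dist_commute)
    then obtain p where "p \<in> frontier D" "z \<in> ball p (\<delta> p)"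
      using \<epsilon>(2) by blast
    then show ?thesis
      using \<delta>(2)[OF _ z(1)] by (auto simp: dist_commute)
  qed
  then show ?thesis
    using \<epsilon>(1) by blast
qed

text \<open>A ball is connected, so if it met D without lying in D it would meet the frontier at
  distance less than d.\<close>

lemma ball_infdist_frontier_subset:
  fixes z :: "'a::real_normed_vector"
  assumes "z \<in> D" "d \<le> infdist z (frontier D)"
  shows "ball z d \<subseteq> D"
proof (rule ccontr)
  assume n: "\<not> ball z d \<subseteq> D"
  then have "0 < d"
    by (metis ball_empty empty_subsetI not_le)
  then have "ball z d \<inter> D \<noteq> {}"
    using assms(1) centre_in_ball by blast
  then have "ball z d \<inter> frontier D \<noteq> {}"
    using n by (intro connected_Int_frontier) auto
  then obtain x where "x \<in> frontier D" "dist z x < d"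
    by auto
  then show False
    using infdist_le[of x "frontier D" z] assms(2) by linarith
qed

lemma eventually_to_frontier:
  "eventually P (to_frontier D) \<longleftrightarrow> (\<exists>\<delta>>0. \<forall>z\<in>D. infdist z (frontier D) < \<delta> \<longrightarrow> P z)"
proof
  assume "eventually P (to_frontier D)"
  then obtain Q where Q: "eventually Q (nhds (0::real))"
    "\<And>z. Q (infdist z (frontier D)) \<Longrightarrow> z \<in> D \<Longrightarrow> P z"
    by (auto simp: to_frontier_def eventually_inf_principal eventually_filtercomap)
  then obtain \<delta> where "\<delta> > 0" "\<And>x. dist x 0 < \<delta> \<Longrightarrow> Q x"
    by (auto simp: eventually_nhds_metric)
  then show "\<exists>\<delta>>0. \<forall>z\<in>D. infdist z (frontier D) < \<delta> \<longrightarrow> P z"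
    using Q(2) infdist_nonneg by (metis abs_of_nonneg dist_0_norm dist_commute real_norm_def)
next
  assume "\<exists>\<delta>>0. \<forall>z\<in>D. infdist z (frontier D) < \<delta> \<longrightarrow> P z"
  then obtain \<delta> where "\<delta> > 0" "\<forall>z\<in>D. infdist z (frontier D) < \<delta> \<longrightarrow> P z"
    by blast
  moreover from this have "eventually (\<lambda>x. x < \<delta>) (nhds (0::real))"
    by (intro eventually_nhds_in_open[of "{..<\<delta>}", simplified])
  ultimately show "eventually P (to_frontier D)"
    unfolding to_frontier_def eventually_inf_principal eventually_filtercomap by blast
qed

theorem theorem5p3:
  fixes D :: "complex set"
  assumes "bounded_domain D" and "smooth_boundary D"
  shows "(squeezing D \<longlongrightarrow> 1) (to_frontier D) \<and> holomorphic_homogeneous_regular D"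
proof
  have dom: "open D" "D \<noteq> {}" "bounded D"
    using assms(1) by (auto simp: bounded_domain_def)
  show "(squeezing D \<longlongrightarrow> 1) (to_frontier D)"
  proof (rule order_tendstoI)
    fix a :: real assume "a < 1"
    \<comment> \<open>A value strictly between a and 1; the maximum with 0 keeps it positive when a
      is negative.\<close>
    define r where "r = (max a 0 + 1) / 2"
    have r: "0 < r" "r < 1" "a < r"
      using \<open>a < 1\<close> by (auto simp: r_def)
    show "eventually (\<lambda>z. a < squeezing D z) (to_frontier D)"
      unfolding eventually_to_frontier
      using squeezing_near_1_uniform[OF assms r(1,2)] r(3) by (meson less_le_trans)
  next
    fix a :: real assume "1 < a"
    show "eventually (\<lambda>z. squeezing D z < a) (to_frontier D)"
      unfolding eventually_to_frontier
      using squeezing_le_1[OF assms(1)] \<open>1 < a\<close> by (intro exI[of _ 1]) fastforce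
  qed
  obtain \<delta> where \<delta>: "\<delta> > 0" "\<And>z. z \<in> D \<Longrightarrow> infdist z (frontier D) < \<delta> \<Longrightarrow> 1 / 2 \<le> squeezing D z"
    using squeezing_near_1_uniform[OF assms, of "1 / 2"] by auto
  obtain R where R: "0 < R" "D \<subseteq> ball 0 R"
    using bounded_subset_ballD[OF dom(3)] by blast
  \<comment> \<open>The bound 1/2 holds within \<open>\<delta>\<close> of the frontier. Elsewhere
    \<open>ball z \<delta>\<close> lies in D, and D lies in \<open>ball z (2 * R)\<close>, so the
    affine bound applies.\<close>
  have "min (1 / 2) (\<delta> / (2 * R)) \<le> squeezing D z" if z: "z \<in> D" for z
  proof (cases "infdist z (frontier D) < \<delta>")
    case True
    then show ?thesis
      using \<delta>(2)[OF z] by linarith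
  next
    case False
    have "D \<subseteq> ball z (2 * R)"
    proof
      fix x assume "x \<in> D"
      then have "dist 0 x < R" "dist 0 z < R"
        using R z by auto
      then show "x \<in> ball z (2 * R)"
        using dist_triangle[of z x 0] by (simp add: dist_commute)
    qed
    then have "\<delta> / (2 * R) \<le> squeezing D z"
      using dom R \<delta>(1) False ball_infdist_frontier_subset[OF z, of \<delta>] by (intro squeezing_ge_affine) auto
    then show ?thesis
      by linarith
  qed
  moreover have "0 < min (1 / 2) (\<delta> / (2 * R))"
    using \<delta> R by simp
  ultimately show "holomorphic_homogeneous_regular D"
    unfolding holomorphic_homogeneous_regular_def using assms(1) by blast
qed

end
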